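(* There is a randomized algorithm which, on input a CNF formula $F$ on $n$ variables and an integer $\mu\le n$, runs in time $O^*(2^{n-\mu})$ and with probability at least $2/3$ does the following: it outputs an integer $u\ge \mu$ such that $U:=2^{u+3}\ge \#F$, and if furthermore $u>\mu$, then $2^{u}$ is a $16$-approximation of $\#F$, i.e. $\tfrac{1}{16}\#F\le 2^{u}\le 16\,\#F$.
   Context: For a CNF formula $F$, $\#F$ denotes the number of its satisfying assignments. The notation $O^*(\cdot)$ suppresses factors sub-exponential in $n$.
   Formalization: The running time O*(2^{n-μ}) is taken to hide also a factor polynomial in the length of the input (F, n and μ in binary), since a CNF formula on n variables can be arbitrarily long and no bound in n and μ alone allows reading it. *)

theory Defs
  imports "HOL-Probability.Probability" "HOL-Library.Landau_Symbols"
begin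

section \<open>CNF formulas and model counting\<close>

text \<open>The literal \<open>(v, b)\<close> is satisfied by the assignments giving the variable \<open>v\<close> the value \<open>b\<close>.\<close>

type_synonym literal = "nat \<times> bool"
type_synonym clause = "literal list"
type_synonym cnf = "clause list"

text \<open>A formula on \<open>n\<close> variables uses variables from \<open>{..<n}\<close>; not all of them have to occur.\<close>

definition cnf_on :: "nat \<Rightarrow> cnf \<Rightarrow> bool" where
  "cnf_on n F \<longleftrightarrow> (\<forall>C\<in>set F. \<forall>(v, b)\<in>set C. v < n)"

definition satisfies :: "(nat \<Rightarrow> bool) \<Rightarrow> cnf \<Rightarrow> bool" where
  "satisfies a F \<longleftrightarrow> (\<forall>C\<in>set F. \<exists>(v, b)\<in>set C. a v = b)"

definition count_sat :: "nat \<Rightarrow> cnf \<Rightarrow> nat" where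
  "count_sat n F = card {a \<in> {..<n} \<rightarrow>\<^sub>E UNIV. satisfies a F}"


section \<open>Randomized programs\<close>

text \<open>
  The machine model is Jones' WHILE language (N. D. Jones, Computability and Complexity from a
  Programming Perspective, MIT Press 1997), extended by fair coin flips: a program has finitely
  many variables holding binary trees, and it can build pairs, project pairs, and test for the
  empty tree. With trees represented by pointers to shared pairs, every command costs a number of
  pointer operations that depends on the program only, not on its input. Trees are never copied or
  compared as a whole.
\<close>

datatype tree = Leaf | Node tree tree

datatype exp = Var nat | Nil_Exp | Cons_Exp exp exp | Hd_Exp exp | Tl_Exp exp

datatype com =
    Skip
  | Assign nat exp
  | Flip nat
  | Seq com com
  | If exp com com
  | While exp com

type_synonym state = "nat \<Rightarrow> tree"

fun left :: "tree \<Rightarrow> tree" where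
  "left Leaf = Leaf"
| "left (Node x y) = x"

fun right :: "tree \<Rightarrow> tree" where
  "right Leaf = Leaf"
| "right (Node x y) = y"

primrec val :: "exp \<Rightarrow> state \<Rightarrow> tree" where
  "val (Var v) s = s v"
| "val Nil_Exp s = Leaf"
| "val (Cons_Exp e e') s = Node (val e s) (val e' s)"
| "val (Hd_Exp e) s = left (val e s)"
| "val (Tl_Exp e) s = right (val e s)"

definition bool_tree :: "bool \<Rightarrow> tree" where
  "bool_tree b = (if b then Node Leaf Leaf else Leaf)"

partial_function (spmf) while_spmf :: "('a \<Rightarrow> bool) \<Rightarrow> ('a \<Rightarrow> 'a spmf) \<Rightarrow> 'a \<Rightarrow> 'a spmf" where
  "while_spmf g f x = (if g x then bind_spmf (f x) (while_spmf g f) else return_spmf x)"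

text \<open>
  The second component of a configuration counts execution steps: one for each elementary command
  and one for each evaluation of a guard. Divergence is the missing probability mass.
\<close>

primrec exec :: "com \<Rightarrow> state \<times> nat \<Rightarrow> (state \<times> nat) spmf" where
  "exec Skip = (\<lambda>(s, t). return_spmf (s, t + 1))"
| "exec (Assign v e) = (\<lambda>(s, t). return_spmf (s(v := val e s), t + 1))"
| "exec (Flip v) = (\<lambda>(s, t). map_spmf (\<lambda>b. (s(v := bool_tree b), t + 1)) coin_spmf)"
| "exec (Seq c d) = (\<lambda>st. bind_spmf (exec c st) (exec d))"
| "exec (If e c d) = (\<lambda>(s, t). if val e s \<noteq> Leaf then exec c (s, t + 1) else exec d (s, t + 1))"
| "exec (While e c) = (\<lambda>(s, t). while_spmf
     (\<lambda>(s, t). val e s \<noteq> Leaf) (\<lambda>(s, t). exec c (s, t + 1)) (s, t + 1))"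

text \<open>Input and output are passed in variable \<open>0\<close>; the result is paired with the number of steps.\<close>

definition run :: "com \<Rightarrow> tree \<Rightarrow> (tree \<times> nat) spmf" where
  "run P x = map_spmf (\<lambda>(s, t). (s 0, t)) (exec P ((\<lambda>_. Leaf)(0 := x), 0))"

text \<open>
  The time bound is a worst-case bound over all coin flips. It also excludes infinite executions:
  after more than \<open>T\<close> steps such an execution would have used only finitely many coin flips, so
  with positive probability the program would still be running.
\<close>

definition runs_in_time :: "com \<Rightarrow> tree \<Rightarrow> real \<Rightarrow> bool" where
  "runs_in_time P x T \<longleftrightarrow>
     lossless_spmf (run P x) \<and> (\<forall>(y, t)\<in>set_spmf (run P x). real t \<le> T)"

definition prob_output :: "com \<Rightarrow> tree \<Rightarrow> (tree \<Rightarrow> bool) \<Rightarrow> real" where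
  "prob_output P x Q = measure (measure_spmf (run P x)) {(y, t). Q y}"


section \<open>Encoding of inputs and outputs\<close>

fun list_tree :: "tree list \<Rightarrow> tree" where
  "list_tree [] = Leaf"
| "list_tree (x # xs) = Node x (list_tree xs)"

text \<open>Binary representation, least significant bit first.\<close>

fun bits :: "nat \<Rightarrow> bool list" where
  "bits n = (if n = 0 then [] else odd n # bits (n div 2))"

declare bits.simps [simp del]

definition nat_tree :: "nat \<Rightarrow> tree" where
  "nat_tree n = list_tree (map bool_tree (bits n))"

definition int_tree :: "int \<Rightarrow> tree" where
  "int_tree i = Node (bool_tree (i < 0)) (nat_tree (nat \<bar>i\<bar>))"

definition literal_tree :: "literal \<Rightarrow> tree" where
  "literal_tree l = Node (nat_tree (fst l)) (bool_tree (snd l))"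

definition cnf_tree :: "cnf \<Rightarrow> tree" where
  "cnf_tree F = list_tree (map (\<lambda>C. list_tree (map literal_tree C)) F)"

definition input_tree :: "nat \<Rightarrow> cnf \<Rightarrow> int \<Rightarrow> tree" where
  "input_tree n F \<mu> = Node (nat_tree n) (Node (int_tree \<mu>) (cnf_tree F))"


section \<open>Sub-exponential factors\<close>

definition subexponential :: "(nat \<Rightarrow> real) \<Rightarrow> bool" where
  "subexponential g \<longleftrightarrow> (\<forall>\<epsilon>>0. g \<in> O(\<lambda>n. 2 powr (\<epsilon> * real n)))"

text \<open>
  The program \<open>P\<close> runs in time \<open>O\<^sup>*(T n \<mu>)\<close>. A formula on \<open>n\<close> variables can be arbitrarily long,
  so no bound in terms of \<open>n\<close> and \<open>\<mu>\<close> alone allows even reading it. As usual, \<open>O\<^sup>*\<close> therefore also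
  hides a polynomial factor in the length of the input (\<open>size\<close> counts the \<open>Node\<close>s). If the length
  of the formula is sub-exponential in \<open>n\<close> and \<open>\<mu> \<ge> 0\<close>, this factor is itself sub-exponential.
\<close>

definition runs_in_O_star :: "com \<Rightarrow> (nat \<Rightarrow> int \<Rightarrow> real) \<Rightarrow> bool" where
  "runs_in_O_star P T \<longleftrightarrow> (\<exists>g k. subexponential g \<and>
     (\<forall>n F \<mu>. cnf_on n F \<and> \<mu> \<le> int n \<longrightarrow>
        runs_in_time P (input_tree n F \<mu>)
          (g n * real (size (input_tree n F \<mu>)) ^ k * T n \<mu>)))"

end

theory Submission
  imports Defs "HOL-Real_Asymp.Real_Asymp"
begin

text \<open>
  Let \<open>d = n - \<mu>\<close>, draw \<open>2 ^ d\<close> independent uniform assignments, and let \<open>h\<close> be the number of those that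
  satisfy \<open>F\<close>. Then \<open>h\<close> is binomially distributed with mean \<open>#F / 2 ^ \<mu>\<close>, and the variance is at most
  the mean. So Chebyshev's and Markov's inequalities bound the failure probability of the estimate
  \<open>u = \<mu> + \<lfloor>log\<^sub>2 h\<rfloor>\<close> (or \<open>u = \<mu>\<close> if \<open>h = 0\<close>) by \<open>2/9 + 1/16 < 1/3\<close>.

  Since \<open>\<mu>\<close> may be a large negative number, \<open>d\<close> is not bounded polynomially in \<open>n\<close> and the input
  length, and the deterministic parts of the program must run in time linear in \<open>2 ^ d\<close>, without a
  factor \<open>d\<close>.
\<close>

section \<open>Reasoning about programs\<close>

notation Seq (infixr ";;" 60)

definition ensures :: "(state \<times> nat) spmf \<Rightarrow> (state \<Rightarrow> nat \<Rightarrow> bool) \<Rightarrow> bool" where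
  "ensures p Q \<longleftrightarrow> lossless_spmf p \<and> (\<forall>(s, t)\<in>set_spmf p. Q s t)"

lemma ensures_return [simp]: "ensures (return_spmf (s, t)) Q \<longleftrightarrow> Q s t"
  by (simp add: ensures_def)

lemma ensures_bind:
  assumes "ensures p Q'" and "\<And>s t. Q' s t \<Longrightarrow> ensures (f (s, t)) Q"
  shows "ensures (bind_spmf p f) Q"
  using assms unfolding ensures_def by (fastforce simp: set_bind_spmf)

lemma ensures_mono:
  "ensures p Q' \<Longrightarrow> (\<And>s t. Q' s t \<Longrightarrow> Q s t) \<Longrightarrow> ensures p Q"
  unfolding ensures_def by blast

lemma ensures_Seq:
  assumes "ensures (exec c (s, t)) Q'" and "\<And>s t. Q' s t \<Longrightarrow> ensures (exec d (s, t)) Q"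
  shows "ensures (exec (c ;; d) (s, t)) Q"
  using assms by (auto intro: ensures_bind)

lemma rel_spmf_bind_ensures:
  assumes "ensures p Q" and "\<And>s t. Q s t \<Longrightarrow> rel_spmf R q (f (s, t))"
  shows "rel_spmf R q (bind_spmf p f)"
  using assms unfolding ensures_def by (intro rel_spmf_bindI2) auto

declare exec.simps(6) [simp del]

definition loop :: "exp \<Rightarrow> com \<Rightarrow> state \<times> nat \<Rightarrow> (state \<times> nat) spmf" where
  "loop e c = while_spmf (\<lambda>(s, t). val e s \<noteq> Leaf) (\<lambda>(s, t). exec c (s, t + 1))"

lemma loop_Leaf: "val e s = Leaf \<Longrightarrow> loop e c (s, t) = return_spmf (s, t)"
  by (simp add: loop_def while_spmf.simps)

lemma loop_step:
  "val e s \<noteq> Leaf \<Longrightarrow> loop e c (s, t) = bind_spmf (exec c (s, t + 1)) (loop e c)"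
  unfolding loop_def by (subst while_spmf.simps) simp

lemma exec_While: "exec (While e c) (s, t) = loop e c (s, t + 1)"
  by (simp add: exec.simps(6) loop_def)

lemma ensures_While:
  fixes m :: "state \<Rightarrow> nat"
  assumes init: "I s (t + 1)"
    and body: "\<And>s t. I s t \<Longrightarrow> val e s \<noteq> Leaf \<Longrightarrow>
      ensures (exec c (s, t + 1)) (\<lambda>s' t'. I s' t' \<and> m s' < m s)"
    and exit: "\<And>s t. I s t \<Longrightarrow> val e s = Leaf \<Longrightarrow> Q s t"
  shows "ensures (exec (While e c) (s, t)) Q"
proof -
  have "ensures (loop e c (s, t)) Q" if "I s t" for s t
    using that
  proof (induction "m s" arbitrary: s t rule: less_induct)
    case less
    show ?case
    proof (cases "val e s = Leaf")
      case True
      then show ?thesis using exit[OF less.prems] by (simp only: loop_Leaf ensures_return)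
    next
      case False
      show ?thesis unfolding loop_step[OF False]
        by (rule ensures_bind[OF body[OF less.prems False]]) (use less.hyps in blast)
    qed
  qed
  from this[OF init] show ?thesis by (simp add: exec_While)
qed

abbreviation unchanged_except :: "nat set \<Rightarrow> state \<Rightarrow> state \<Rightarrow> bool" where
  "unchanged_except V s s' \<equiv> \<forall>v. v \<notin> V \<longrightarrow> s' v = s v"

section \<open>Arithmetic on trees\<close>

text \<open>
  A tree represents in unary the length of its right spine. This ignores the elements of a list,
  so every list doubles as a loop counter.
\<close>

primrec len :: "tree \<Rightarrow> nat" where
  "len Leaf = 0"
| "len (Node x y) = Suc (len y)"

primrec bin_val :: "tree \<Rightarrow> nat" where
  "bin_val Leaf = 0"
| "bin_val (Node x y) = of_bool (x \<noteq> Leaf) + 2 * bin_val y"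

lemma len_eq_0 [simp]: "len x = 0 \<longleftrightarrow> x = Leaf"
  by (cases x) auto

lemma len_right: "len (right x) = len x - 1"
  by (cases x) auto

lemma len_pos: "x \<noteq> Leaf \<Longrightarrow> 0 < len x"
  by (cases x) auto

lemma len_funpow_right: "len ((right ^^ k) x) = len x - k"
  by (induction k) (auto simp: len_right)

lemma bool_tree_eq_Leaf [simp]: "bool_tree b = Leaf \<longleftrightarrow> \<not> b"
  by (simp add: bool_tree_def)

lemma list_tree_eq_Leaf [simp]:
  "list_tree xs = Leaf \<longleftrightarrow> xs = []" "Leaf = list_tree xs \<longleftrightarrow> xs = []"
  by (cases xs; simp)+

lemma len_list_tree [simp]: "len (list_tree xs) = length xs"
  by (induction xs) auto

lemma funpow_right_list_tree: "(right ^^ k) (list_tree xs) = list_tree (drop k xs)"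
proof (induction k arbitrary: xs)
  case (Suc k)
  show ?case
  proof (cases xs)
    case Nil
    then show ?thesis using Suc[of "[]"] by simp
  next
    case (Cons x ys)
    then show ?thesis using Suc[of ys] by (simp add: funpow_swap1)
  qed
qed simp

lemma bits_0 [simp]: "bits 0 = []"
  by (subst bits.simps) simp

lemma bits_pos: "n > 0 \<Longrightarrow> bits n = odd n # bits (n div 2)"
  by (subst bits.simps) simp

lemma bin_val_nat_tree [simp]: "bin_val (nat_tree n) = n"
proof (induction n rule: less_induct)
  case (less n)
  show ?case
  proof (cases "n = 0")
    case True
    then show ?thesis by (simp add: nat_tree_def)
  next
    case False
    with less[of "n div 2"] show ?thesis by (simp add: nat_tree_def bits_pos)
  qed
qed

lemma length_bits_bounds:
  assumes "0 < n"
  shows "2 ^ (length (bits n) - 1) \<le> n" "n < 2 * 2 ^ (length (bits n) - 1)"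
proof -
  have "2 ^ (length (bits n) - 1) \<le> n \<and> n < 2 ^ length (bits n)" using assms
  proof (induction n rule: less_induct)
    case (less n)
    show ?case
    proof (cases "n div 2 = 0")
      case True
      then have "n = 1" using less.prems by simp
      then show ?thesis by (simp add: bits_pos)
    next
      case False
      then have "2 ^ (length (bits (n div 2)) - 1) \<le> n div 2 \<and> n div 2 < 2 ^ length (bits (n div 2))"
        using less by simp
      moreover have "(2::nat) ^ length (bits (n div 2)) = 2 * 2 ^ (length (bits (n div 2)) - 1)"
        using False by (simp add: bits_pos)
      moreover have "bits n = odd n # bits (n div 2)"
        using less.prems by (rule bits_pos)
      ultimately show ?thesis by simp linarith
    qed
  qed
  moreover have "length (bits n) = Suc (length (bits n) - 1)"
    using assms by (simp add: bits_pos)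
  then have "(2::nat) ^ length (bits n) = 2 * 2 ^ (length (bits n) - 1)"
    by (metis power_Suc)
  ultimately show "2 ^ (length (bits n) - 1) \<le> n" "n < 2 * 2 ^ (length (bits n) - 1)" by simp_all
qed

lemma length_bits: "2 ^ length (bits n) \<le> 2 * n + 1"
proof (cases "n = 0")
  case False
  then have "(2::nat) ^ length (bits n) = 2 * 2 ^ (length (bits n) - 1)"
    by (simp add: bits_pos)
  then show ?thesis using length_bits_bounds(1)[of n] False by simp
qed simp

lemma len_nat_tree: "len (nat_tree n) = length (bits n)"
  by (simp add: nat_tree_def)

abbreviation True_Exp :: exp where
  "True_Exp \<equiv> Cons_Exp Nil_Exp Nil_Exp"

abbreviation Pop :: "nat \<Rightarrow> com" where
  "Pop v \<equiv> Assign v (Tl_Exp (Var v))"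

abbreviation Incr :: "nat \<Rightarrow> com" where
  "Incr v \<equiv> Assign v (Cons_Exp Nil_Exp (Var v))"

text \<open>
  Variables with a fixed role: 7 holds \<open>n\<close> and 18 holds \<open>d\<close>, both in unary; 8 holds the formula, 10 the
  remaining rounds, 11 the hits, 12 the sampled assignment, 16 and 17 whether the current clause and
  the formula are satisfied. Arguments and results of the arithmetic routines are passed in
  4 (unary), 6 (unary, or a list to be shortened), 5 (binary, most significant bit first) and
  9 (binary, least significant bit first).
\<close>

text \<open>Since \<open>right Leaf = Leaf\<close>, this is truncated subtraction on unary numbers.\<close>

definition drop_com :: com where
  "drop_com = While (Var 4) (Pop 6 ;; Pop 4)"

lemma ensures_drop:
  "ensures (exec drop_com (s, t)) (\<lambda>s' t'. s' 6 = (right ^^ len (s 4)) (s 6) \<and>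
     t' \<le> t + 3 * len (s 4) + 1 \<and> unchanged_except {4, 6} s s')"
  unfolding drop_com_def
proof (rule ensures_While[where m = "\<lambda>s. len (s 4)" and I = "\<lambda>s' t'.
    (right ^^ len (s' 4)) (s' 6) = (right ^^ len (s 4)) (s 6) \<and>
    t' + 3 * len (s' 4) \<le> t + 3 * len (s 4) + 1 \<and> unchanged_except {4, 6} s s'"], goal_cases)
  case (2 s' t')
  then obtain x y where "s' 4 = Node x y" by (cases "s' 4") auto
  with 2 show ?case by (simp add: funpow_swap1)
qed simp_all

text \<open>
  Besides the value of the binary number in variable 9, the program computes in variable 2 a power
  of two. Thus applied to a number \<open>d\<close> in unary it computes \<open>2 ^ d\<close>.
\<close>

definition from_bin :: com where
  "from_bin =
     Assign 2 True_Exp ;;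
     Assign 4 Nil_Exp ;;
     While (Var 9)
      (Assign 3 Nil_Exp ;;
       While (Var 2)
         (Incr 3 ;; Incr 3 ;; If (Hd_Exp (Var 9)) (Incr 4) Skip ;; Pop 2) ;;
       Assign 2 (Var 3) ;;
       Pop 9)"

lemma ensures_from_bin_inner:
  "ensures (exec (While (Var 2)
      (Incr 3 ;; Incr 3 ;; If (Hd_Exp (Var 9)) (Incr 4) Skip ;; Pop 2)) (s, t))
    (\<lambda>s' t'. len (s' 3) = len (s 3) + 2 * len (s 2) \<and>
      len (s' 4) = len (s 4) + of_bool (left (s 9) \<noteq> Leaf) * len (s 2) \<and>
      t' \<le> t + 6 * len (s 2) + 1 \<and> unchanged_except {2, 3, 4} s s')"
proof (rule ensures_While[where m = "\<lambda>s. len (s 2)" and I = "\<lambda>s' t'.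
    len (s' 3) + 2 * len (s' 2) = len (s 3) + 2 * len (s 2) \<and>
    len (s' 4) + of_bool (left (s 9) \<noteq> Leaf) * len (s' 2) =
      len (s 4) + of_bool (left (s 9) \<noteq> Leaf) * len (s 2) \<and>
    t' + 6 * len (s' 2) \<le> t + 6 * len (s 2) + 1 \<and> unchanged_except {2, 3, 4} s s'"], goal_cases)
  case (2 s' t')
  then obtain x y where "s' 2 = Node x y" by (cases "s' 2") auto
  with 2 show ?case by auto
qed simp_all

lemma ensures_from_bin:
  "ensures (exec from_bin (s, t)) (\<lambda>s' t'. len (s' 4) = bin_val (s 9) \<and>
     len (s' 2) = 2 ^ len (s 9) \<and> t' \<le> t + 12 * 2 ^ len (s 9) \<and> unchanged_except {2, 3, 4, 9} s s')"
proof -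
  have "ensures (exec (While (Var 9)
      (Assign 3 Nil_Exp ;;
       While (Var 2)
         (Incr 3 ;; Incr 3 ;; If (Hd_Exp (Var 9)) (Incr 4) Skip ;; Pop 2) ;;
       Assign 2 (Var 3) ;;
       Pop 9)) (s(2 := Node Leaf Leaf, 4 := Leaf), t + 2)) (\<lambda>s' t'. len (s' 4) = bin_val (s 9) \<and>
     len (s' 2) = 2 ^ len (s 9) \<and> t' \<le> t + 12 * 2 ^ len (s 9) \<and> unchanged_except {2, 3, 4, 9} s s')"
  proof (rule ensures_While[where m = "\<lambda>s. len (s 9)" and I = "\<lambda>s' t'.
      len (s' 4) + len (s' 2) * bin_val (s' 9) = bin_val (s 9) \<and>
      len (s' 2) * 2 ^ len (s' 9) = 2 ^ len (s 9) \<and> 0 < len (s' 2) \<and>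
      t' + 9 \<le> t + 12 * len (s' 2) \<and> unchanged_except {2, 3, 4, 9} s s'"], goal_cases)
    case (2 s' t')
    then obtain x y where s'9: "s' 9 = Node x y" by (cases "s' 9") auto
    show ?case
      apply simp
      apply (rule ensures_bind[OF ensures_from_bin_inner])
      using 2 s'9 apply (auto simp: algebra_simps)
      done
  qed auto
  then show ?thesis by (simp add: from_bin_def)
qed

definition to_bin :: com where
  "to_bin =
     Assign 5 Nil_Exp ;;
     While (Var 4)
      (Assign 2 Nil_Exp ;;
       While (Tl_Exp (Var 4)) (Incr 2 ;; Pop 4 ;; Pop 4) ;;
       If (Var 4) (Assign 5 (Cons_Exp True_Exp (Var 5))) (Incr 5) ;;
       Assign 4 (Var 2))"

lemma ensures_halve:
  "ensures (exec (While (Tl_Exp (Var 4)) (Incr 2 ;; Pop 4 ;; Pop 4)) (s, t))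
    (\<lambda>s' t'. len (s' 2) = len (s 2) + len (s 4) div 2 \<and> len (s' 4) = len (s 4) mod 2 \<and>
      t' \<le> t + 4 * len (s 4) + 1 \<and> unchanged_except {2, 4} s s')"
proof (rule ensures_While[where m = "\<lambda>s. len (s 4)" and I = "\<lambda>s' t'.
    len (s' 2) + len (s' 4) div 2 = len (s 2) + len (s 4) div 2 \<and>
    len (s' 4) mod 2 = len (s 4) mod 2 \<and>
    t' + 4 * len (s' 4) \<le> t + 4 * len (s 4) + 1 \<and> unchanged_except {2, 4} s s'"], goal_cases)
  case (2 s' t')
  then obtain x y z where "s' 4 = Node x (Node y z)"
    by (metis left.cases right.simps val.simps(1,5))
  with 2 show ?case by auto
next
  case (3 s' t')
  then have "len (right (s' 4)) = 0" by simp
  then have "len (s' 4) < 2" unfolding len_right by simp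
  with 3 show ?case by auto
qed simp_all

lemma ensures_to_bin:
  "ensures (exec to_bin (s, t)) (\<lambda>s' t'. s' 5 = list_tree (map bool_tree (rev (bits (len (s 4))))) \<and>
     t' \<le> t + 20 * len (s 4) + 2 \<and> unchanged_except {2, 4, 5} s s')"
proof -
  let ?I = "\<lambda>s' t'. (\<exists>bs. s' 5 = list_tree (map bool_tree (rev bs)) \<and> bs @ bits (len (s' 4)) = bits (len (s 4))) \<and>
      t' + 20 * len (s' 4) \<le> t + 20 * len (s 4) + 2 \<and> unchanged_except {2, 4, 5} s s'"
  have "ensures (exec (While (Var 4)
      (Assign 2 Nil_Exp ;;
       While (Tl_Exp (Var 4)) (Incr 2 ;; Pop 4 ;; Pop 4) ;;
       If (Var 4) (Assign 5 (Cons_Exp True_Exp (Var 5))) (Incr 5) ;;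
       Assign 4 (Var 2))) (s(5 := Leaf), t + 1))
      (\<lambda>s' t'. s' 5 = list_tree (map bool_tree (rev (bits (len (s 4))))) \<and>
       t' \<le> t + 20 * len (s 4) + 2 \<and> unchanged_except {2, 4, 5} s s')"
  proof (rule ensures_While[where m = "\<lambda>s. len (s 4)" and I = ?I], goal_cases)
    case (2 s1 t1)
    then obtain bs where bs: "s1 5 = list_tree (map bool_tree (rev bs))"
      "bs @ bits (len (s1 4)) = bits (len (s 4))" by blast
    have pos: "0 < len (s1 4)" using 2 by (simp add: len_pos)
    have post: "?I (s'(4 := s' 2)) (t' + 1) \<and> len ((s'(4 := s' 2)) 4) < len (s1 4)"
      if "s' 5 = Node (bool_tree (odd (len (s1 4)))) (s1 5)" "len (s' 2) = len (s1 4) div 2"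
        "t' \<le> t1 + 5 + 4 * len (s1 4)" "unchanged_except {2, 4, 5} s1 s'" for s' t'
    proof -
      have "s' 5 = list_tree (map bool_tree (rev (bs @ [odd (len (s1 4))])))"
        using that bs by simp
      moreover have "(bs @ [odd (len (s1 4))]) @ bits (len (s' 2)) = bits (len (s 4))"
        using bs pos that by (simp add: bits_pos)
      moreover have "t' + 1 + 20 * len (s' 2) \<le> t + 20 * len (s 4) + 2"
        using that 2 pos by linarith
      ultimately show ?thesis using that 2 pos by (auto simp del: rev_append)
    qed
    show ?case
      apply simp
      apply (rule ensures_bind[OF ensures_halve])
      subgoal for s' t'
        using post[of "s'(5 := Node (bool_tree (odd (len (s1 4)))) (s1 5))" "Suc (Suc t')"]
          len_eq_0[of "s' 4"]
        by (cases "odd (len (s1 4))") (simp_all add: bool_tree_def odd_iff_mod_2_eq_one even_iff_mod_2_eq_zero)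
      done
  next
    case (3 s' t')
    then show ?case by auto
  qed (auto intro: exI[of _ "[]"])
  then show ?thesis by (simp add: to_bin_def)
qed

definition rev_com :: com where
  "rev_com = Assign 9 Nil_Exp ;; While (Var 5) (Assign 9 (Cons_Exp (Hd_Exp (Var 5)) (Var 9)) ;; Pop 5)"

lemma ensures_rev:
  assumes "s 5 = list_tree xs"
  shows "ensures (exec rev_com (s, t)) (\<lambda>s' t'. s' 9 = list_tree (rev xs) \<and>
     t' \<le> t + 3 * length xs + 2 \<and> unchanged_except {5, 9} s s')"
proof -
  have "ensures (exec (While (Var 5) (Assign 9 (Cons_Exp (Hd_Exp (Var 5)) (Var 9)) ;; Pop 5)) (s(9 := Leaf), t + 1))
     (\<lambda>s' t'. s' 9 = list_tree (rev xs) \<and>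
     t' \<le> t + 3 * length xs + 2 \<and> unchanged_except {5, 9} s s')"
  proof (rule ensures_While[where m = "\<lambda>s. len (s 5)" and I = "\<lambda>s' t'.
      (\<exists>ys zs. s' 5 = list_tree ys \<and> s' 9 = list_tree zs \<and> rev ys @ zs = rev xs) \<and>
      t' + 3 * len (s' 5) \<le> t + 3 * length xs + 2 \<and> unchanged_except {5, 9} s s'"], goal_cases)
    case (2 s' t')
    then obtain y ys zs where "s' 5 = list_tree (y # ys)" "s' 9 = list_tree zs" "rev (y # ys) @ zs = rev xs"
      by (metis list_tree_eq_Leaf neq_Nil_conv val.simps(1))
    moreover from this have "\<exists>ys' zs'. list_tree ys = list_tree ys' \<and> Node y (list_tree zs) = list_tree zs' \<and>
        rev ys' @ zs' = rev xs"
      by (intro exI[of _ ys] exI[of _ "y # zs"]) simp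
    ultimately show ?case using 2 by simp
  next
    case 1
    show ?case using assms by (auto intro: exI[of _ "[]"])
  qed auto
  then show ?thesis by (simp add: rev_com_def)
qed

section \<open>Evaluating the formula\<close>

definition check_literal :: com where
  "check_literal =
     Assign 9 (Hd_Exp (Hd_Exp (Var 15))) ;;
     from_bin ;;
     Assign 6 (Var 12) ;;
     drop_com ;;
     If (Hd_Exp (Var 6))
       (If (Tl_Exp (Hd_Exp (Var 15))) (Assign 16 True_Exp) Skip)
       (If (Tl_Exp (Hd_Exp (Var 15))) Skip (Assign 16 True_Exp))"

lemma ensures_check_literal:
  assumes "s 15 = Node (literal_tree (v, b)) x" "s 12 = list_tree (map bool_tree bs)" "v < length bs"
  shows "ensures (exec check_literal (s, t)) (\<lambda>s' t'.
    (s' 16 \<noteq> Leaf \<longleftrightarrow> s 16 \<noteq> Leaf \<or> bs ! v = b) \<and>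
    t' \<le> t + 27 * length bs + 17 \<and> unchanged_except {2, 3, 4, 6, 9, 16} s s')"
proof -
  have "left (list_tree (drop v (map bool_tree bs))) = bool_tree (bs ! v)"
    using assms(3) by (simp add: Cons_nth_drop_Suc[symmetric] drop_map)
  moreover have "12 * 2 ^ len (nat_tree v) \<le> 24 * v + 12"
    using length_bits[of v] by (simp add: len_nat_tree)
  ultimately show ?thesis
    unfolding check_literal_def using assms
    apply (simp add: literal_tree_def)
    apply (rule ensures_bind[OF ensures_from_bin], simp)
    apply (rule ensures_bind[OF ensures_drop], simp add: funpow_right_list_tree)
    done
qed

definition check_clause :: com where
  "check_clause =
     Assign 15 (Hd_Exp (Var 14)) ;;
     Assign 16 Nil_Exp ;;
     While (Var 15) (check_literal ;; Pop 15)"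

lemma ensures_check_clause:
  assumes "s 14 = Node (list_tree (map literal_tree C)) x" "s 12 = list_tree (map bool_tree bs)"
    and "\<forall>(v, b)\<in>set C. v < length bs"
  shows "ensures (exec check_clause (s, t)) (\<lambda>s' t'.
    (s' 16 \<noteq> Leaf \<longleftrightarrow> (\<exists>(v, b)\<in>set C. bs ! v = b)) \<and>
    t' \<le> t + (27 * length bs + 19) * length C + 3 \<and> unchanged_except {2, 3, 4, 6, 9, 15, 16} s s')"
proof -
  let ?sat = "\<lambda>C. \<exists>(v, b)\<in>set C. bs ! v = b"
  define J where "J x y \<longleftrightarrow> (\<exists>C'. x = list_tree (map literal_tree C') \<and> set C' \<subseteq> set C \<and>
      (?sat C \<longleftrightarrow> y \<noteq> Leaf \<or> ?sat C'))" for x y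
  let ?I = "\<lambda>s' t'. J (s' 15) (s' 16) \<and>
      t' + (27 * length bs + 19) * len (s' 15) \<le> t + (27 * length bs + 19) * length C + 3 \<and>
      unchanged_except {2, 3, 4, 6, 9, 15, 16} s s'"
  have "ensures (exec (While (Var 15) (check_literal ;; Pop 15))
      (s(15 := list_tree (map literal_tree C), 16 := Leaf), t + 2)) (\<lambda>s' t'.
    (s' 16 \<noteq> Leaf \<longleftrightarrow> ?sat C) \<and>
    t' \<le> t + (27 * length bs + 19) * length C + 3 \<and> unchanged_except {2, 3, 4, 6, 9, 15, 16} s s')"
  proof (rule ensures_While[where m = "\<lambda>s. len (s 15)" and I = ?I], goal_cases)
    case (2 s1 t1)
    then obtain L where L: "s1 15 = list_tree (map literal_tree L)" "set L \<subseteq> set C"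
      "?sat C \<longleftrightarrow> s1 16 \<noteq> Leaf \<or> ?sat L" unfolding J_def by blast
    with 2(2) have "L \<noteq> []" by auto
    then obtain l C' where "L = l # C'" by (cases L) simp
    moreover obtain v b where "l = (v, b)" by (rule prod.exhaust)
    ultimately have C': "s1 15 = list_tree (map literal_tree ((v, b) # C'))"
      "set ((v, b) # C') \<subseteq> set C" "?sat C \<longleftrightarrow> s1 16 \<noteq> Leaf \<or> ?sat ((v, b) # C')"
      using L by simp_all
    have v: "v < length bs" using C'(2) assms(3) by auto
    have *: "?I s' t' \<and> len (s' 15) < len (s1 15)"
      if "s' 16 \<noteq> Leaf \<longleftrightarrow> s1 16 \<noteq> Leaf \<or> bs ! v = b" "t' \<le> t1 + 27 * length bs + 19"
        "s' 15 = list_tree (map literal_tree C')" "unchanged_except {2, 3, 4, 6, 9, 15, 16} s1 s'" for s' t'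
    proof -
      have "J (s' 15) (s' 16)"
        unfolding J_def using that C' by (intro exI[of _ C']) auto
      moreover have "t' + (27 * length bs + 19) * len (s' 15) \<le> t + (27 * length bs + 19) * length C + 3"
        using that C' 2 by (simp add: algebra_simps)
      ultimately show ?thesis using that C' 2 by simp
    qed
    show ?case
      apply simp
      apply (rule ensures_bind[OF ensures_check_literal[where bs = bs]])
      using C' apply simp
      using 2 assms apply simp
      apply (rule v)
      subgoal for s' t'
        using *[of "s'(15 := right (s' 15))" "Suc t'"] C' by simp
      done
  next
    case 1
    show ?case by (auto simp: J_def intro!: exI[of _ C])
  next
    case (3 s' t')
    then show ?case by (auto simp: J_def)
  qed
  then show ?thesis unfolding check_clause_def using assms by simp
qed

definition cost :: "cnf \<Rightarrow> nat" where
  "cost F = (\<Sum>C\<leftarrow>F. length C + 1)"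

definition check :: com where
  "check =
     Assign 17 True_Exp ;;
     Assign 14 (Var 8) ;;
     While (Var 14) (check_clause ;; If (Var 16) Skip (Assign 17 Nil_Exp) ;; Pop 14)"

lemma ensures_check:
  assumes "s 8 = cnf_tree F" "s 12 = list_tree (map bool_tree bs)" "cnf_on (length bs) F"
  shows "ensures (exec check (s, t)) (\<lambda>s' t'.
    (s' 17 \<noteq> Leaf \<longleftrightarrow> satisfies ((!) bs) F) \<and>
    t' \<le> t + (27 * length bs + 19) * cost F + 3 \<and> unchanged_except {2, 3, 4, 6, 9, 14, 15, 16, 17} s s')"
proof -
  define J where "J x y t' \<longleftrightarrow> (\<exists>F'. x = cnf_tree F' \<and> set F' \<subseteq> set F \<and>
      (satisfies ((!) bs) F \<longleftrightarrow> y \<noteq> Leaf \<and> satisfies ((!) bs) F') \<and>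
      t' + (27 * length bs + 19) * cost F' \<le> t + (27 * length bs + 19) * cost F + 3)" for x y t'
  let ?I = "\<lambda>s' t'. J (s' 14) (s' 17) t' \<and>
      unchanged_except {2, 3, 4, 6, 9, 14, 15, 16, 17} s s'"
  have "ensures (exec (While (Var 14) (check_clause ;; If (Var 16) Skip (Assign 17 Nil_Exp) ;; Pop 14))
      (s(17 := Node Leaf Leaf, 14 := cnf_tree F), t + 2)) (\<lambda>s' t'.
    (s' 17 \<noteq> Leaf \<longleftrightarrow> satisfies ((!) bs) F) \<and>
    t' \<le> t + (27 * length bs + 19) * cost F + 3 \<and> unchanged_except {2, 3, 4, 6, 9, 14, 15, 16, 17} s s')"
  proof (rule ensures_While[where m = "\<lambda>s. len (s 14)" and I = ?I], goal_cases)
    case (2 s1 t1)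
    then obtain G where G: "s1 14 = cnf_tree G" "set G \<subseteq> set F"
      "satisfies ((!) bs) F \<longleftrightarrow> s1 17 \<noteq> Leaf \<and> satisfies ((!) bs) G"
      "t1 + (27 * length bs + 19) * cost G \<le> t + (27 * length bs + 19) * cost F + 3" unfolding J_def by blast
    with 2(2) have "G \<noteq> []" by (auto simp: cnf_tree_def)
    then obtain C F' where "G = C # F'" by (cases G) simp
    then have F': "s1 14 = cnf_tree (C # F')" "set (C # F') \<subseteq> set F"
      "satisfies ((!) bs) F \<longleftrightarrow> s1 17 \<noteq> Leaf \<and> satisfies ((!) bs) (C # F')"
      "t1 + (27 * length bs + 19) * cost (C # F') \<le> t + (27 * length bs + 19) * cost F + 3"
      using G by simp_all
    have C: "\<forall>(v, b)\<in>set C. v < length bs"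
      using F'(2) assms(3) by (auto simp: cnf_on_def)
    have *: "?I s' t' \<and> len (s' 14) < len (s1 14)"
      if "s' 17 \<noteq> Leaf \<longleftrightarrow> s1 17 \<noteq> Leaf \<and> (\<exists>(v, b)\<in>set C. bs ! v = b)"
        "t' \<le> t1 + (27 * length bs + 19) * length C + 7"
        "s' 14 = cnf_tree F'" "unchanged_except {2, 3, 4, 6, 9, 14, 15, 16, 17} s1 s'" for s' t'
    proof -
      have "t' + (27 * length bs + 19) * cost F' \<le> t + (27 * length bs + 19) * cost F + 3"
        using that F'(4) by (simp add: algebra_simps cost_def)
      then have "J (s' 14) (s' 17) t'"
        unfolding J_def using that F' by (intro exI[of _ F']) (auto simp: satisfies_def)
      then show ?thesis using that F' 2 by (simp add: cnf_tree_def)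
    qed
    show ?case
      apply simp
      apply (rule ensures_bind[OF ensures_check_clause[where bs = bs and C = C]])
      using F' apply (simp add: cnf_tree_def)
      using 2 assms apply simp
      using C apply simp
      subgoal for s' t'
        apply (cases "s' 16 = Leaf")
        subgoal using *[of "s'(17 := Leaf, 14 := right (s' 14))" "Suc (Suc (Suc t'))"] F'(1)
          by (simp add: cnf_tree_def)
        subgoal using *[of "s'(14 := right (s' 14))" "Suc (Suc (Suc t'))"] F'(1)
          by (simp add: cnf_tree_def)
        done
      done
  next
    case 1
    show ?case by (auto simp: J_def intro!: exI[of _ F])
  next
    case (3 s' t')
    then show ?case by (auto simp: J_def cnf_tree_def satisfies_def)
  qed
  then show ?thesis unfolding check_def using assms by simp
qed

section \<open>Sampling\<close>

abbreviation coin_pmf :: "bool pmf" where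
  "coin_pmf \<equiv> pmf_of_set UNIV"

lemma finite_bool_lists: "finite {bs :: bool list. length bs = n}"
  and card_bool_lists: "card {bs :: bool list. length bs = n} = 2 ^ n"
  using finite_lists_length_eq[of "UNIV :: bool set" n] card_lists_length_eq[of "UNIV :: bool set" n]
  by simp_all

lemma replicate_coin_pmf: "replicate_pmf n coin_pmf = pmf_of_set {bs. length bs = n}"
proof (rule pmf_eqI)
  fix bs :: "bool list"
  have *: "pmf (replicate_pmf n coin_pmf) bs = (if length bs = n then (1 / 2) ^ n else 0)"
  proof (induction n arbitrary: bs)
    case (Suc n)
    show ?case
    proof (cases bs)
      case Nil
      then show ?thesis by (simp add: pmf_eq_0_set_pmf set_replicate_pmf del: replicate_pmf.simps)
    next
      case (Cons b cs)
      have "replicate_pmf (Suc n) coin_pmf = map_pmf (\<lambda>(x, xs). x # xs) (pair_pmf coin_pmf (replicate_pmf n coin_pmf))"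
        by (simp add: pair_pmf_def map_bind_pmf)
      then have "pmf (replicate_pmf (Suc n) coin_pmf) bs = pmf (map_pmf (\<lambda>(x, xs). x # xs) (pair_pmf coin_pmf (replicate_pmf n coin_pmf))) ((\<lambda>(x, xs). x # xs) (b, cs))"
        using Cons by simp
      also have "\<dots> = pmf (pair_pmf coin_pmf (replicate_pmf n coin_pmf)) (b, cs)"
        by (rule pmf_map_inj') (auto simp: inj_def)
      also have "\<dots> = 1 / 2 * pmf (replicate_pmf n coin_pmf) cs"
        by (simp add: pmf_pair)
      finally show ?thesis using Suc[of cs] Cons by (cases "length cs = n") (simp_all del: replicate_pmf.simps)
    qed
  qed (simp add: pmf_return)
  show "pmf (replicate_pmf n coin_pmf) bs = pmf (pmf_of_set {bs. length bs = n}) bs"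
    unfolding * by (subst pmf_of_set) (auto simp: finite_bool_lists card_bool_lists power_divide indicator_def intro: Ex_list_of_length)
qed

lemma count_sat_lists:
  assumes "cnf_on n F"
  shows "count_sat n F = card {bs. length bs = n \<and> satisfies ((!) (rev bs)) F}"
  unfolding count_sat_def
proof (rule bij_betw_same_card)
  have sat: "satisfies a F \<longleftrightarrow> satisfies b F" if "\<And>v. v < n \<Longrightarrow> a v = b v" for a b
    using assms that unfolding satisfies_def cnf_on_def
    by (intro ball_cong bex_cong refl) force
  show "bij_betw (\<lambda>a. rev (map a [0..<n])) {a \<in> {..<n} \<rightarrow>\<^sub>E UNIV. satisfies a F}
      {bs. length bs = n \<and> satisfies ((!) (rev bs)) F}"
  proof (rule bij_betw_byWitness[where f' = "\<lambda>bs. restrict ((!) (rev bs)) {..<n}"], goal_cases)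
    case 1
    show ?case by (auto simp: restrict_def fun_eq_iff PiE_def extensional_def)
  next
    case 2
    have "map (restrict ((!) (rev bs)) {..<n}) [0..<n] = rev bs" if "length bs = n" for bs :: "bool list"
      using that by (intro nth_equalityI) simp_all
    then show ?case by simp
  next
    case 3
    have "satisfies ((!) (map a [0..<n])) F \<longleftrightarrow> satisfies a F" for a
      by (rule sat) simp
    then show ?case by auto
  next
    case 4
    have "satisfies (restrict ((!) (rev bs)) {..<n}) F \<longleftrightarrow> satisfies ((!) (rev bs)) F" for bs
      by (rule sat) simp
    then show ?case by auto
  qed
qed

lemma count_sat_le:
  assumes "cnf_on n F"
  shows "count_sat n F \<le> 2 ^ n"
proof -
  have "count_sat n F \<le> card {bs :: bool list. length bs = n}"
    unfolding count_sat_lists[OF assms] by (rule card_mono[OF finite_bool_lists]) auto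
  then show ?thesis by (simp add: card_bool_lists)
qed

lemma map_replicate_coin_pmf:
  assumes "cnf_on n F"
  shows "map_pmf (\<lambda>bs. satisfies ((!) (rev bs)) F) (replicate_pmf n coin_pmf) =
    bernoulli_pmf (count_sat n F / 2 ^ n)"
proof -
  let ?A = "{bs. satisfies ((!) (rev bs)) F}" and ?B = "{bs :: bool list. length bs = n}"
  note fin = finite_bool_lists[of n] and card = card_bool_lists[of n]
  have ne: "?B \<noteq> {}" using Ex_list_of_length by auto
  have "?A \<inter> ?B = {bs. length bs = n \<and> satisfies ((!) (rev bs)) F}" by auto
  then have "map_spmf (\<lambda>bs. bs \<in> ?A) (spmf_of_set ?B) = spmf_of_pmf (bernoulli_pmf (count_sat n F / 2 ^ n))"
    by (subst map_mem_spmf_of_set) (use fin ne card count_sat_lists[OF assms] in simp_all)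
  then have "spmf_of_pmf (map_pmf (\<lambda>bs. bs \<in> ?A) (pmf_of_set ?B)) = spmf_of_pmf (bernoulli_pmf (count_sat n F / 2 ^ n))"
    using fin ne by (simp flip: map_spmf_of_pmf)
  then show ?thesis
    unfolding replicate_coin_pmf spmf_of_pmf_def by (simp add: inj_eq[OF pmf.inj_map[OF inj_Some]])
qed

definition sample :: com where
  "sample =
     Assign 12 Nil_Exp ;;
     Assign 4 (Var 7) ;;
     While (Var 4) (Flip 13 ;; Assign 12 (Cons_Exp (Var 13) (Var 12)) ;; Pop 4)"

lemma spmf_of_replicate_pmf_Suc:
  "spmf_of_pmf (replicate_pmf (Suc n) p) =
   bind_spmf (spmf_of_pmf p) (\<lambda>x. map_spmf ((#) x) (spmf_of_pmf (replicate_pmf n p)))"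
  by (simp add: spmf_of_pmf_bind bind_pmf_return_spmf)

lemma rel_spmf_sample_loop:
  assumes "s 12 = list_tree (map bool_tree cs)"
  shows "rel_spmf (\<lambda>bs (s', t'). s' 12 = list_tree (map bool_tree (rev bs @ cs)) \<and>
      length bs = len (s 4) \<and> t' \<le> t + 4 * len (s 4) \<and> unchanged_except {4, 12, 13} s s')
    (spmf_of_pmf (replicate_pmf (len (s 4)) coin_pmf))
    (loop (Var 4) (Flip 13 ;; Assign 12 (Cons_Exp (Var 13) (Var 12)) ;; Pop 4) (s, t))"
  using assms
proof (induction "len (s 4)" arbitrary: s t cs)
  case 0
  then show ?case by (subst loop_Leaf) auto
next
  case (Suc n)
  then have ne: "val (Var 4) s \<noteq> Leaf" by auto
  show ?case
    unfolding loop_step[OF ne] Suc(2)[symmetric] spmf_of_replicate_pmf_Suc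
    apply (simp add: bind_map_spmf o_def map_spmf_bind_spmf)
    apply (rule rel_spmf_bind_reflI)
    subgoal for b
      unfolding map_spmf_of_pmf[symmetric] spmf_rel_map
      using Suc(1)[of "s(13 := bool_tree b, 12 := Node (bool_tree b) (s 12), 4 := right (s 4))" "b # cs" "Suc (Suc (Suc (Suc t)))"] Suc(2)[symmetric] Suc(3)
      apply (simp add: len_right)
      apply (erule rel_spmf_mono)
      apply auto
      done
    done
qed


lemma rel_spmf_sample:
  "rel_spmf (\<lambda>bs (s', t'). s' 12 = list_tree (map bool_tree (rev bs)) \<and>
      length bs = len (s 7) \<and> t' \<le> t + 4 * len (s 7) + 3 \<and> unchanged_except {4, 12, 13} s s')
    (spmf_of_pmf (replicate_pmf (len (s 7)) coin_pmf)) (exec sample (s, t))"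
proof -
  let ?s = "s(12 := Leaf, 4 := s 7)"
  have "exec sample (s, t) = loop (Var 4) (Flip 13 ;; Assign 12 (Cons_Exp (Var 13) (Var 12)) ;; Pop 4) (?s, t + 3)"
    by (simp add: sample_def exec_While numeral_3_eq_3)
  then show ?thesis
    using rel_spmf_sample_loop[of ?s "[]" "t + 3"] by (auto elim!: rel_spmf_mono)
qed

lemma rel_spmf_return_ensures:
  "rel_spmf (\<lambda>x (s, t). R x s t) (return_spmf x) p \<longleftrightarrow> ensures p (R x)"
  by (simp add: rel_spmf_return_spmf1 ensures_def)

definition round_com :: com where
  "round_com = sample ;; check ;; If (Var 17) (Incr 11) Skip ;; Pop 10"

abbreviation scratch :: "nat set" where
  "scratch \<equiv> {2, 3, 4, 6, 9, 10, 11, 12, 13, 14, 15, 16, 17}"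

definition round_cost :: "nat \<Rightarrow> cnf \<Rightarrow> nat" where
  "round_cost n F = 31 * n + 27 * n * cost F + 19 * cost F + 9"

lemma rel_spmf_round:
  assumes "s 8 = cnf_tree F" "len (s 7) = n" "cnf_on n F"
  shows "rel_spmf (\<lambda>b (s', t'). len (s' 11) = len (s 11) + of_bool b \<and> s' 10 = right (s 10) \<and>
      t' \<le> t + round_cost n F \<and> unchanged_except scratch s s')
    (spmf_of_pmf (bernoulli_pmf (count_sat n F / 2 ^ n))) (exec round_com (s, t))"
proof -
  have eq: "spmf_of_pmf (bernoulli_pmf (count_sat n F / 2 ^ n)) =
      bind_spmf (spmf_of_pmf (replicate_pmf n coin_pmf)) (\<lambda>bs. return_spmf (satisfies ((!) (rev bs)) F))"
    by (simp add: bind_pmf_return_spmf map_replicate_coin_pmf[OF assms(3)])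
  have step: "rel_spmf (\<lambda>b (s', t'). len (s' 11) = len (s 11) + of_bool b \<and> s' 10 = right (s 10) \<and>
      t' \<le> t + round_cost n F \<and> unchanged_except scratch s s')
      (return_spmf (satisfies ((!) (rev bs)) F)) (exec (check ;; If (Var 17) (Incr 11) Skip ;; Pop 10) (s1, t1))"
    if "s1 12 = list_tree (map bool_tree (rev bs)) \<and> length bs = len (s 7) \<and> t1 \<le> t + 4 * len (s 7) + 3 \<and>
      unchanged_except {4, 12, 13} s s1" for bs s1 t1
    unfolding rel_spmf_return_ensures
    apply (rule ensures_Seq[OF ensures_check[where bs = "rev bs" and F = F]])
    using that assms apply simp_all[3]
    using that assms(2) apply (auto simp: round_cost_def algebra_simps)
    done
  show ?thesis
    unfolding round_com_def exec.simps(4)[of sample] eq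
  proof (rule rel_spmf_bindI[OF rel_spmf_sample[of s t, unfolded assms(2)]], goal_cases)
    case (1 bs y)
    then show ?case using step[of "fst y" bs "snd y"] assms(2)
      by (simp add: case_prod_beta del: exec.simps)
  qed
qed

lemma rel_spmf_rounds:
  assumes "s 8 = cnf_tree F" "len (s 7) = n" "cnf_on n F"
  shows "rel_spmf (\<lambda>h (s', t'). len (s' 11) = len (s 11) + h \<and>
      t' \<le> t + (round_cost n F + 1) * len (s 10) \<and> unchanged_except scratch s s')
    (spmf_of_pmf (binomial_pmf (len (s 10)) (count_sat n F / 2 ^ n))) (loop (Var 10) round_com (s, t))"
proof -
  let ?q = "count_sat n F / 2 ^ n"
  have "real (count_sat n F) \<le> 2 ^ n"
    using count_sat_le[OF assms(3)] by simp
  then have q: "?q \<in> {0..1}" by simp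
  show ?thesis using assms(1,2)
  proof (induction "len (s 10)" arbitrary: s t)
    case 0
    then show ?case by (subst loop_Leaf) (auto simp: binomial_pmf_0[OF q])
  next
    case (Suc m)
    then have ne: "val (Var 10) s \<noteq> Leaf" by auto
    have eq: "spmf_of_pmf (binomial_pmf (Suc m) ?q) =
        bind_spmf (spmf_of_pmf (bernoulli_pmf ?q)) (\<lambda>b. map_spmf (\<lambda>k. (if b then 1 else 0) + k) (spmf_of_pmf (binomial_pmf m ?q)))"
      by (simp add: binomial_pmf_Suc[OF q] spmf_of_pmf_bind bind_pmf_return_spmf)
    show ?case
      unfolding loop_step[OF ne] Suc(2)[symmetric] eq
    proof (rule rel_spmf_bindI[OF rel_spmf_round[OF Suc(3,4) assms(3)]], clarify, goal_cases)
      case (1 b s1 t1)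
      have len: "m = len (s1 10)" using 1 Suc(2) by (simp add: len_right)
      have "s1 8 = cnf_tree F" "len (s1 7) = n" using 1 Suc(3,4) by simp_all
      from Suc(1)[OF len this, of t1] show ?case
        unfolding len[symmetric] spmf_rel_map
        by (rule rel_spmf_mono) (use 1 in \<open>auto simp: algebra_simps\<close>)
    qed
  qed

qed

section \<open>The quality of the estimate\<close>

lemma binomial_pmf_Suc_expectation:
  fixes f :: "nat \<Rightarrow> real"
  assumes "p \<in> {0..1}"
  shows "measure_pmf.expectation (binomial_pmf (Suc n) p) f =
    p * measure_pmf.expectation (binomial_pmf n p) (\<lambda>k. f (Suc k)) +
    (1 - p) * measure_pmf.expectation (binomial_pmf n p) f"
proof -
  have "binomial_pmf (Suc n) p =
      bernoulli_pmf p \<bind> (\<lambda>b. map_pmf (\<lambda>k. (if b then 1 else 0) + k) (binomial_pmf n p))"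
    by (simp add: binomial_pmf_Suc[OF assms] map_pmf_def)
  then show ?thesis
    using assms by (simp only:, subst pmf_expectation_bind[where A = UNIV])
      (auto simp: finite_set_pmf_binomial_pmf UNIV_bool)
qed

lemma binomial_pmf_moments:
  assumes "p \<in> {0..1}"
  shows "measure_pmf.expectation (binomial_pmf n p) real = n * p"
    and "measure_pmf.expectation (binomial_pmf n p) (\<lambda>k. (real k)\<^sup>2) = n * p * (1 - p) + (n * p)\<^sup>2"
proof -
  have "measure_pmf.expectation (binomial_pmf n p) real = n * p \<and>
    measure_pmf.expectation (binomial_pmf n p) (\<lambda>k. (real k)\<^sup>2) = n * p * (1 - p) + (n * p)\<^sup>2"
  proof (induction n)
    case 0
    show ?case using assms by (simp add: binomial_pmf_0)
  next
    case (Suc n)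
    have int: "integrable (binomial_pmf n p) f" for f :: "nat \<Rightarrow> real"
      using assms by (intro integrable_measure_pmf_finite finite_set_pmf_binomial_pmf)
    have "measure_pmf.expectation (binomial_pmf n p) (\<lambda>k. real (Suc k)) =
        measure_pmf.expectation (binomial_pmf n p) real + 1"
      by (simp add: int algebra_simps)
    moreover have "measure_pmf.expectation (binomial_pmf n p) (\<lambda>k. (real (Suc k))\<^sup>2) =
        measure_pmf.expectation (binomial_pmf n p) (\<lambda>k. (real k)\<^sup>2) +
        2 * measure_pmf.expectation (binomial_pmf n p) real + 1"
      by (simp add: int power2_eq_square algebra_simps)
    ultimately show ?case
      using Suc by (simp add: binomial_pmf_Suc_expectation[OF assms] power2_eq_square algebra_simps)
  qed
  then show "measure_pmf.expectation (binomial_pmf n p) real = n * p"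
    "measure_pmf.expectation (binomial_pmf n p) (\<lambda>k. (real k)\<^sup>2) = n * p * (1 - p) + (n * p)\<^sup>2"
    by simp_all
qed

lemma binomial_pmf_variance:
  assumes "p \<in> {0..1}"
  shows "measure_pmf.variance (binomial_pmf n p) real = n * p * (1 - p)"
  using assms
  by (subst measure_pmf.variance_eq)
    (simp_all add: binomial_pmf_moments integrable_measure_pmf_finite finite_set_pmf_binomial_pmf)

text \<open>The truncated subtraction makes \<open>log2 0 = 0\<close>, which gives the output \<open>u = \<mu>\<close> if there is no hit.\<close>

definition log2 :: "nat \<Rightarrow> nat" where
  "log2 h = length (bits h) - 1"

text \<open>
  The number of hits is too small with probability at most \<open>2/9\<close> by Chebyshev's inequality, and too
  large with probability at most \<open>1/16\<close> by Markov's inequality.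
\<close>

lemma binomial_pmf_log2_approx:
  fixes R :: real
  assumes p: "p \<in> {0..1}" and R: "R = N * p"
  shows "measure_pmf.prob (binomial_pmf N p)
    {h. R \<le> 8 * 2 ^ log2 h \<and> (0 < log2 h \<longrightarrow> R / 16 \<le> 2 ^ log2 h \<and> 2 ^ log2 h \<le> 16 * R)} \<ge> 2 / 3"
proof -
  let ?M = "binomial_pmf N p"
  let ?G = "{h. R \<le> 8 * 2 ^ log2 h \<and> (0 < log2 h \<longrightarrow> R / 16 \<le> 2 ^ log2 h \<and> 2 ^ log2 h \<le> 16 * R)}"
  let ?A = "{h. R > 8 \<and> real h < R / 4}" and ?B = "{h. 0 < h \<and> 16 * R < real h}"
  have int: "integrable ?M f" for f :: "nat \<Rightarrow> real"
    using p by (intro integrable_measure_pmf_finite finite_set_pmf_binomial_pmf)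
  have "R \<ge> 0" using p R by simp
  have A: "measure_pmf.prob ?M ?A \<le> 2 / 9"
  proof (cases "R > 8")
    case True
    have "measure_pmf.prob ?M ?A \<le> measure_pmf.prob ?M {h. 3 / 4 * R \<le> \<bar>real h - R\<bar>}"
      using True by (intro measure_pmf.finite_measure_mono) auto
    also have "\<dots> \<le> measure_pmf.variance ?M real / (3 / 4 * R)\<^sup>2"
      using measure_pmf.Chebyshev_inequality[of real ?M "3 / 4 * R"] True int
      by (simp add: binomial_pmf_moments[OF p] R mult.commute[of p])
    also have "\<dots> \<le> R / (3 / 4 * R)\<^sup>2"
    proof (rule divide_right_mono)
      have "R * (1 - p) \<le> R * 1" using p \<open>R \<ge> 0\<close> by (intro mult_left_mono) auto
      then show "measure_pmf.variance ?M real \<le> R"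
        by (simp add: binomial_pmf_variance[OF p] R)
    qed simp
    also have "\<dots> = 16 / (9 * R)"
      using True by (simp add: power2_eq_square field_simps)
    also have "\<dots> \<le> 2 / 9" using True by (simp add: field_simps)
    finally show ?thesis .
  qed simp
  have B: "measure_pmf.prob ?M ?B \<le> 1 / 16"
  proof (cases "R = 0")
    case True
    have "measure_pmf.prob ?M ?B \<le> measure_pmf.prob ?M {h. 1 \<le> real h}"
      by (intro measure_pmf.finite_measure_mono) auto
    also have "\<dots> \<le> measure_pmf.expectation ?M real / 1"
      using integral_Markov_inequality_measure[of ?M real "{}" 1] int by simp
    finally have "measure_pmf.prob ?M ?B \<le> R"
      by (simp only: binomial_pmf_moments(1)[OF p] R div_by_1)
    then show ?thesis using True by linarith
  next
    case False
    then have "R > 0" using \<open>R \<ge> 0\<close> by simp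
    have "measure_pmf.prob ?M ?B \<le> measure_pmf.prob ?M {h. 16 * R \<le> real h}"
      by (intro measure_pmf.finite_measure_mono) auto
    also have "\<dots> \<le> measure_pmf.expectation ?M real / (16 * R)"
      using integral_Markov_inequality_measure[of ?M real "{}" "16 * R"] int \<open>R > 0\<close> by simp
    also have "\<dots> = 1 / 16"
      using \<open>R > 0\<close> by (simp add: binomial_pmf_moments[OF p] flip: R)
    finally show ?thesis .
  qed
  have "- ?G \<subseteq> ?A \<union> ?B"
  proof
    fix h assume "h \<in> - ?G"
    then have bad: "8 * 2 ^ log2 h < R \<or> 0 < log2 h \<and> 16 * R < 2 ^ log2 h"
      using \<open>R \<ge> 0\<close> by (auto simp: not_le)
    show "h \<in> ?A \<union> ?B"
    proof (cases "h = 0")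
      case True
      then show ?thesis using bad \<open>R \<ge> 0\<close> by (auto simp: log2_def)
    next
      case False
      then have "2 ^ log2 h \<le> h" "h < 2 * 2 ^ log2 h"
        using length_bits_bounds[of h] by (simp_all add: log2_def)
      then have "2 ^ log2 h \<le> real h" "real h < 2 * 2 ^ log2 h"
        by (metis of_nat_le_iff of_nat_numeral of_nat_power,
            metis of_nat_less_iff of_nat_mult of_nat_numeral of_nat_power)
      moreover have "(1::real) \<le> 2 ^ log2 h" by simp
      ultimately have "R > 8 \<and> real h < R / 4 \<or> 16 * R < real h"
        using bad by linarith
      then show ?thesis using False by blast
    qed
  qed
  then have "measure_pmf.prob ?M (- ?G) \<le> measure_pmf.prob ?M (?A \<union> ?B)"
    by (intro measure_pmf.finite_measure_mono) auto
  also have "\<dots> \<le> measure_pmf.prob ?M ?A + measure_pmf.prob ?M ?B"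
    by (intro measure_Un_le) auto
  also have "\<dots> \<le> 1 / 3" using A B by simp
  finally show ?thesis
    using measure_pmf.prob_compl[of ?G ?M] by (simp add: Compl_eq_Diff_UNIV)
qed

section \<open>The program\<close>

definition add_com :: com where
  "add_com = While (Var 4) (Incr 6 ;; Pop 4)"

lemma ensures_add:
  "ensures (exec add_com (s, t)) (\<lambda>s' t'. len (s' 6) = len (s 6) + len (s 4) \<and>
     t' \<le> t + 3 * len (s 4) + 1 \<and> unchanged_except {4, 6} s s')"
  unfolding add_com_def
proof (rule ensures_While[where m = "\<lambda>s. len (s 4)" and I = "\<lambda>s' t'.
    len (s' 6) + len (s' 4) = len (s 6) + len (s 4) \<and>
    t' + 3 * len (s' 4) \<le> t + 3 * len (s 4) + 1 \<and> unchanged_except {4, 6} s s'"], goal_cases)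
  case (2 s' t')
  then obtain x y where "s' 4 = Node x y" by (cases "s' 4") auto
  with 2 show ?case by simp
qed simp_all

definition prepare :: com where
  "prepare =
     Assign 9 (Hd_Exp (Var 0)) ;;
     from_bin ;;
     Assign 7 (Var 4) ;;
     Assign 9 (Tl_Exp (Hd_Exp (Tl_Exp (Var 0)))) ;;
     from_bin ;;
     Assign 8 (Tl_Exp (Tl_Exp (Var 0))) ;;
     Assign 6 (Var 7) ;;
     If (Hd_Exp (Hd_Exp (Tl_Exp (Var 0)))) add_com drop_com ;;
     Assign 18 (Var 6) ;;
     Assign 9 (Var 18) ;;
     from_bin ;;
     Assign 10 (Var 2) ;;
     Assign 11 Nil_Exp"

lemma ensures_from_bin_nat_tree:
  assumes "s 9 = nat_tree m"
  shows "ensures (exec from_bin (s, t)) (\<lambda>s' t'. len (s' 4) = m \<and>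
     t' \<le> t + 24 * m + 12 \<and> unchanged_except {2, 3, 4, 9} s s')"
  using length_bits[of m] assms
  by (intro ensures_mono[OF ensures_from_bin]) (simp add: len_nat_tree)

lemma ensures_prepare:
  assumes "s 0 = input_tree n F \<mu>" "\<mu> \<le> int n"
  defines "d \<equiv> nat (int n - \<mu>)"
  shows "ensures (exec prepare (s, t)) (\<lambda>s' t'. len (s' 7) = n \<and> s' 8 = cnf_tree F \<and>
    len (s' 18) = d \<and> len (s' 10) = 2 ^ d \<and> s' 11 = Leaf \<and> t' \<le> t + 51 * n + 80 * 2 ^ d)"
proof -
  let ?m = "nat \<bar>\<mu>\<bar>"
  have add_drop: "ensures (exec (If (Hd_Exp (Hd_Exp (Tl_Exp (Var 0)))) add_com drop_com) (s1, t1))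
      (\<lambda>s' t'. len (s' 6) = d \<and> t' \<le> t1 + 3 * ?m + 2 \<and> unchanged_except {4, 6} s1 s')"
    if "s1 0 = input_tree n F \<mu>" "len (s1 4) = ?m" "len (s1 6) = n" for s1 t1
  proof (cases "\<mu> < 0")
    case True
    then have "d = n + ?m" unfolding d_def by simp
    then show ?thesis using that True
      by (simp add: input_tree_def int_tree_def)
        (rule ensures_mono[OF ensures_add], simp)
  next
    case False
    then have "d = n - ?m" unfolding d_def by simp
    then show ?thesis using that False
      by (simp add: input_tree_def int_tree_def)
        (rule ensures_mono[OF ensures_drop], simp add: len_funpow_right)
  qed
  have "d < 2 ^ d" by (rule less_exp)
  moreover have "?m \<le> n + d" unfolding d_def using assms(2) by simp
  ultimately have bound: "27 * ?m + 12 * 2 ^ d + 40 \<le> 27 * n + 80 * 2 ^ d" by linarith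
  show ?thesis
    unfolding prepare_def
    apply (simp only: exec.simps(2,4) case_prod_conv return_bind_spmf)
    apply (rule ensures_bind[OF ensures_from_bin_nat_tree[where m = n]])
     apply (simp add: assms(1) input_tree_def)
    apply (simp only: exec.simps(2,4) case_prod_conv return_bind_spmf)
    apply (rule ensures_bind[OF ensures_from_bin_nat_tree[where m = ?m]])
     apply (simp add: assms(1) input_tree_def int_tree_def)
    apply (simp only: exec.simps(2,4) case_prod_conv return_bind_spmf)
    apply (rule ensures_bind[OF add_drop])
       apply (simp_all add: assms(1) del: exec.simps)[3]
    apply (simp only: exec.simps(2,4) case_prod_conv return_bind_spmf)
    apply (rule ensures_bind[OF ensures_from_bin])
    using bound assms(1) apply (simp add: input_tree_def)
    done
qed

text \<open>
  Writing \<open>u = n - e\<close> with \<open>e = d - log2 h \<ge> 0\<close>, the truncated differences of \<open>n\<close> and \<open>e\<close> in both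
  directions give the absolute value and the sign of \<open>u\<close>.
\<close>

definition finish :: com where
  "finish =
     Assign 4 (Var 11) ;;
     to_bin ;;
     Assign 6 (Var 18) ;; Assign 4 (Tl_Exp (Var 5)) ;; drop_com ;; Assign 18 (Var 6) ;;
     Assign 6 (Var 7) ;; Assign 4 (Var 18) ;; drop_com ;; Assign 10 (Var 6) ;;
     Assign 6 (Var 18) ;; Assign 4 (Var 7) ;; drop_com ;;
     If (Var 6)
       (Assign 17 True_Exp ;; Assign 4 (Var 6))
       (Assign 17 Nil_Exp ;; Assign 4 (Var 10)) ;;
     to_bin ;;
     rev_com ;;
     Assign 0 (Cons_Exp (Var 17) (Var 9))"

lemma length_bits_le: "length (bits n) \<le> n"
proof (cases "n = 0")
  case False
  then have "length (bits n) - 1 < n"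
    using length_bits_bounds(1)[of n] less_exp[of "length (bits n) - 1"] by linarith
  then show ?thesis by simp
qed simp

lemma ensures_finish:
  assumes "len (s 7) = n" "len (s 18) = d" "len (s 11) = h" "h \<le> 2 ^ d"
  shows "ensures (exec finish (s, t)) (\<lambda>s' t'. s' 0 = int_tree (int n - int d + int (log2 h)) \<and>
    t' \<le> t + 29 * n + 100 * 2 ^ d)"
proof -
  have "log2 h \<le> d"
  proof (cases "h = 0")
    case False
    then have "2 ^ log2 h \<le> h"
      unfolding log2_def by (intro length_bits_bounds) simp
    then have "(2::nat) ^ log2 h \<le> 2 ^ d" using assms(4) by (rule order_trans)
    then show ?thesis by simp
  qed (simp add: log2_def)
  define e where "e = d - log2 h"
  define u where "u = int n - int e"
  have u: "int n - int d + int (log2 h) = u"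
    unfolding u_def e_def using \<open>log2 h \<le> d\<close> by simp
  have sign: "ensures (exec (If (Var 6) (Assign 17 True_Exp ;; Assign 4 (Var 6))
      (Assign 17 Nil_Exp ;; Assign 4 (Var 10))) (s1, t1))
      (\<lambda>s' t'. s' 17 = bool_tree (u < 0) \<and> len (s' 4) = nat \<bar>u\<bar> \<and> t' \<le> t1 + 3)"
    if "len (s1 6) = e - n" "len (s1 10) = n - e" for s1 t1
  proof (cases "s1 6 = Leaf")
    case True
    then have "e \<le> n" using that(1) by simp
    then show ?thesis using that(2) True by (simp add: u_def bool_tree_def nat_diff_distrib)
  next
    case False
    then have "n < e" using that(1) len_pos[of "s1 6"] by simp
    then show ?thesis using that(1) False by (simp add: u_def bool_tree_def nat_diff_distrib)
  qed
  have "d < 2 ^ d" by (rule less_exp)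
  moreover have "nat \<bar>u\<bar> \<le> n + d" "e \<le> d" "log2 h \<le> d"
    using \<open>log2 h \<le> d\<close> by (auto simp: u_def e_def)
  ultimately have bound: "20 * h + 3 * log2 h + 3 * e + 23 * nat \<bar>u\<bar> + 3 * n + 50 \<le> 26 * n + 100 * 2 ^ d"
    using assms(4) by linarith
  show ?thesis
    unfolding finish_def u
    apply (simp only: exec.simps(2,4) case_prod_conv return_bind_spmf)
    apply (rule ensures_bind[OF ensures_to_bin])
    apply (simp only: exec.simps(2,4) case_prod_conv return_bind_spmf)
    apply (rule ensures_bind[OF ensures_drop])
    apply (simp only: exec.simps(2,4) case_prod_conv return_bind_spmf)
    apply (rule ensures_bind[OF ensures_drop])
    apply (simp only: exec.simps(2,4) case_prod_conv return_bind_spmf)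
    apply (rule ensures_bind[OF ensures_drop])
    apply (rule ensures_bind[OF sign])
      apply (use assms in \<open>simp add: len_funpow_right len_right log2_def e_def\<close>)
     apply (use assms in \<open>simp add: len_funpow_right len_right log2_def e_def\<close>)
    apply (rule ensures_bind[OF ensures_to_bin])
    apply (rule ensures_bind[OF ensures_rev], simp)
    using bound assms length_bits_le[of "nat \<bar>u\<bar>"]
    apply (simp add: int_tree_def nat_tree_def rev_map len_funpow_right len_right log2_def e_def)
    done
qed

definition approx_count :: com where
  "approx_count = prepare ;; While (Var 10) round_com ;; finish"

lemma rel_spmf_approx_count:
  assumes F: "cnf_on n F" and \<mu>: "\<mu> \<le> int n"
  defines "d \<equiv> nat (int n - \<mu>)"
  shows "rel_spmf (\<lambda>h (y, t). y = int_tree (\<mu> + int (log2 h)) \<and>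
      t \<le> 80 * n + (round_cost n F + 182) * 2 ^ d)
    (spmf_of_pmf (binomial_pmf (2 ^ d) (count_sat n F / 2 ^ n))) (run approx_count (input_tree n F \<mu>))"
proof -
  let ?x = "input_tree n F \<mu>"
  let ?M = "spmf_of_pmf (binomial_pmf (2 ^ d) (count_sat n F / 2 ^ n))"
  let ?R = "\<lambda>h (s', t'). s' 0 = int_tree (\<mu> + int (log2 h)) \<and>
      t' \<le> 80 * n + (round_cost n F + 182) * 2 ^ d"
  have "real (count_sat n F) \<le> 2 ^ n"
    using count_sat_le[OF F] by simp
  then have q: "0 \<le> count_sat n F / 2 ^ n" "count_sat n F / 2 ^ n \<le> 1" by simp_all
  have "rel_spmf ?R ?M (exec approx_count ((\<lambda>_. Leaf)(0 := ?x), 0))"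
    unfolding approx_count_def exec.simps(4)[of prepare]
  proof (rule rel_spmf_bind_ensures[OF ensures_prepare[OF _ \<mu>, of _ F, folded d_def]], goal_cases)
    case 1
    show ?case by simp
  next
    case (2 s t)
    then have "rel_spmf (\<lambda>h (s', t'). len (s' 11) = h \<and> t' \<le> t + 1 + (round_cost n F + 1) * 2 ^ d \<and>
        unchanged_except scratch s s') ?M (exec (While (Var 10) round_com) (s, t))"
      using rel_spmf_rounds[of s F n "t + 1"] F by (simp add: exec_While)
    then have "rel_spmf (\<lambda>h (s', t'). len (s' 11) = h \<and> h \<le> 2 ^ d \<and> t' \<le> t + 1 + (round_cost n F + 1) * 2 ^ d \<and>
        unchanged_except scratch s s') ?M (exec (While (Var 10) round_com) (s, t))"
      by (rule rel_spmf_mono_strong) (use q in \<open>auto simp: set_pmf_binomial_eq split: if_splits\<close>)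
    then have "rel_spmf ?R (bind_spmf ?M return_spmf) (exec (While (Var 10) round_com ;; finish) (s, t))"
      unfolding exec.simps(4)
    proof (rule rel_spmf_bindI, goal_cases)
      case (1 h y)
      obtain s1 t1 where y: "y = (s1, t1)" by (rule prod.exhaust)
      have "int n - int d = \<mu>" using \<mu> by (simp add: d_def)
      then have "ensures (exec finish (s1, t1)) (\<lambda>s' t'. s' 0 = int_tree (\<mu> + int (log2 h)) \<and>
          t' \<le> t1 + 29 * n + 100 * 2 ^ d)"
        using ensures_finish[of s1 n d h t1] 1 2 by (simp add: y)
      moreover have "t' \<le> 80 * n + (round_cost n F + 182) * 2 ^ d" if "t' \<le> t1 + 29 * n + 100 * 2 ^ d" for t'
      proof -
        have "t \<le> 51 * n + 80 * 2 ^ d" "t1 \<le> t + 1 + (round_cost n F + 1) * 2 ^ d"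
          using 1 2 by (simp_all add: y)
        moreover have "(1::nat) \<le> 2 ^ d" by simp
        ultimately show ?thesis using that unfolding add_mult_distrib by linarith
      qed
      ultimately have "ensures (exec finish (s1, t1)) (\<lambda>s' t'. ?R h (s', t'))"
        by (auto elim: ensures_mono)
      then show ?case by (simp add: y rel_spmf_return_ensures[of "\<lambda>h s t. ?R h (s, t)", simplified])
    qed
    then show ?case by simp
  qed
  then show ?thesis
    unfolding run_def spmf_rel_map by (rule rel_spmf_mono) auto
qed

lemma size_list_tree: "size (list_tree xs) = (\<Sum>x\<leftarrow>xs. size x + 1)"
  by (induction xs) auto

lemma cost_le_size: "cost F \<le> size (input_tree n F \<mu>)"
proof -
  have "length C \<le> size (list_tree (map literal_tree C))" for C
    by (induction C) auto
  then have "cost F \<le> size (cnf_tree F)"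
    unfolding cost_def cnf_tree_def size_list_tree map_map o_def by (intro sum_list_mono) simp
  then show ?thesis by (simp add: input_tree_def)
qed

lemma subexponential_linear: "subexponential (\<lambda>n. c * (real n + 1))"
  unfolding subexponential_def
proof (intro allI impI)
  fix \<epsilon> :: real assume "0 < \<epsilon>"
  then show "(\<lambda>n. c * (real n + 1)) \<in> O(\<lambda>n. 2 powr (\<epsilon> * real n))"
    by real_asymp
qed

lemma runs_in_O_star_approx_count: "runs_in_O_star approx_count (\<lambda>n \<mu>. 2 powi (int n - \<mu>))"
  unfolding runs_in_O_star_def
proof (intro exI conjI allI impI)
  show "subexponential (\<lambda>n. 400 * (real n + 1))" by (rule subexponential_linear)
  fix n F and \<mu> :: int
  assume "cnf_on n F \<and> \<mu> \<le> int n"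
  then have F: "cnf_on n F" and \<mu>: "\<mu> \<le> int n" by auto
  let ?x = "input_tree n F \<mu>"
  define d where "d = nat (int n - \<mu>)"
  note rel = rel_spmf_approx_count[OF F \<mu>, folded d_def]
  have "1 \<le> size ?x" by (simp add: input_tree_def)
  have "80 * n + (round_cost n F + 182) * 2 ^ d \<le> (80 * n + round_cost n F + 182) * 2 ^ d"
    by (simp add: add_mult_distrib)
  also have "\<dots> \<le> (400 * (n + 1) * size ?x) * 2 ^ d"
  proof (rule mult_right_mono)
    have "80 * n + round_cost n F + 182 = 111 * n + 191 + (27 * n + 19) * cost F"
      by (simp add: round_cost_def algebra_simps)
    also have "\<dots> \<le> (111 * n + 191) * size ?x + (27 * n + 19) * size ?x"
      using \<open>1 \<le> size ?x\<close> cost_le_size[of F n \<mu>] by (intro add_mono mult_left_mono) simp_all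
    also have "\<dots> \<le> 400 * (n + 1) * size ?x"
      unfolding add_mult_distrib[symmetric] by (intro mult_right_mono) simp_all
    finally show "80 * n + round_cost n F + 182 \<le> 400 * (n + 1) * size ?x" .
  qed simp
  finally have "real t \<le> 400 * (real n + 1) * real (size ?x) ^ 1 * 2 powi (int n - \<mu>)"
    if "t \<le> 80 * n + (round_cost n F + 182) * 2 ^ d" for t
  proof -
    assume le: "80 * n + (round_cost n F + 182) * 2 ^ d \<le> 400 * (n + 1) * size ?x * 2 ^ d"
    have "(2::real) powi (int n - \<mu>) = 2 ^ d"
      using \<mu> by (simp add: power_int_def d_def)
    moreover have "real t \<le> real (400 * (n + 1) * size ?x * 2 ^ d)"
      using that le by (simp only: of_nat_le_iff)
    ultimately show ?thesis by (simp add: add.commute)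
  qed
  moreover have "lossless_spmf (run approx_count ?x)"
    using rel_spmf_weightD[OF rel] by (simp add: lossless_spmf_def)
  moreover have "t \<le> 80 * n + (round_cost n F + 182) * 2 ^ d" if "(y, t) \<in> set_spmf (run approx_count ?x)" for y t
    using rel_funD[OF set_spmf_parametric rel] that by (auto dest: rel_setD2)
  ultimately show "runs_in_time approx_count ?x
      (400 * (real n + 1) * real (size ?x) ^ 1 * 2 powi (int n - \<mu>))"
    unfolding runs_in_time_def by blast
qed

theorem theorem3:
  shows "\<exists>P :: com.
    runs_in_O_star P (\<lambda>n \<mu>. 2 powi (int n - \<mu>)) \<and>
    (\<forall>(n :: nat) (F :: cnf) (\<mu> :: int). cnf_on n F \<and> \<mu> \<le> int n \<longrightarrow>
      prob_output P (input_tree n F \<mu>)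
        (\<lambda>y. \<exists>u :: int. y = int_tree u \<and> u \<ge> \<mu> \<and>
           2 powi (u + 3) \<ge> real (count_sat n F) \<and>
           (u > \<mu> \<longrightarrow>
              1 / 16 * real (count_sat n F) \<le> 2 powi u \<and>
              2 powi u \<le> 16 * real (count_sat n F)))
      \<ge> 2 / 3)"
proof (intro exI[of _ approx_count] conjI runs_in_O_star_approx_count allI impI)
  fix n F and \<mu> :: int
  assume "cnf_on n F \<and> \<mu> \<le> int n"
  then have F: "cnf_on n F" and \<mu>: "\<mu> \<le> int n" by auto
  let ?x = "input_tree n F \<mu>"
  define d where "d = nat (int n - \<mu>)"
  define R where "R = 2 ^ d * (count_sat n F / 2 ^ n)"
  let ?M = "binomial_pmf (2 ^ d) (count_sat n F / 2 ^ n)"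
  define G where "G = {h. R \<le> 8 * 2 ^ log2 h \<and> (0 < log2 h \<longrightarrow> R / 16 \<le> 2 ^ log2 h \<and> 2 ^ log2 h \<le> 16 * R)}"
  define good where "good y \<longleftrightarrow> (\<exists>u :: int. y = int_tree u \<and> u \<ge> \<mu> \<and>
           2 powi (u + 3) \<ge> real (count_sat n F) \<and>
           (u > \<mu> \<longrightarrow>
              1 / 16 * real (count_sat n F) \<le> 2 powi u \<and>
              2 powi u \<le> 16 * real (count_sat n F)))" for y
  have "real (count_sat n F) \<le> 2 ^ n"
    using count_sat_le[OF F] by simp
  then have q: "count_sat n F / 2 ^ n \<in> {0..1}" by simp
  have count: "real (count_sat n F) = 2 powi \<mu> * R"
  proof -
    have "(2::real) powi \<mu> * 2 ^ d = 2 powi (\<mu> + int d)"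
      by (simp add: power_int_add)
    also have "\<mu> + int d = int n" using \<mu> by (simp add: d_def)
    finally have "(2::real) powi \<mu> * 2 ^ d = 2 ^ n" by simp
    moreover have "2 powi \<mu> * R = 2 powi \<mu> * 2 ^ d * (count_sat n F / 2 ^ n)"
      by (simp add: R_def)
    ultimately show ?thesis by simp
  qed
  have good: "good (int_tree (\<mu> + int (log2 h)))" if "h \<in> G" for h
    unfolding good_def
  proof (intro exI[of _ "\<mu> + int (log2 h)"] conjI impI refl)
    have pos: "(0::real) < 2 powi \<mu>" by simp
    have "(2::real) powi (\<mu> + int (log2 h) + 3) = 2 powi \<mu> * (8 * 2 ^ log2 h)"
      by (simp add: power_int_add)
    then show "real (count_sat n F) \<le> 2 powi (\<mu> + int (log2 h) + 3)"
      unfolding count using that pos by (simp add: G_def)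
    assume "\<mu> < \<mu> + int (log2 h)"
    then have "R / 16 \<le> 2 ^ log2 h" "2 ^ log2 h \<le> 16 * R" using that by (simp_all add: G_def)
    then have "2 powi \<mu> * (R / 16) \<le> 2 powi \<mu> * 2 ^ log2 h" "2 powi \<mu> * 2 ^ log2 h \<le> 2 powi \<mu> * (16 * R)"
      using pos by (simp_all only: mult_le_cancel_left_pos)
    then show "1 / 16 * real (count_sat n F) \<le> 2 powi (\<mu> + int (log2 h))"
      "2 powi (\<mu> + int (log2 h)) \<le> 16 * real (count_sat n F)"
      unfolding count by (simp_all add: power_int_add)
  qed simp
  have "2 / 3 \<le> measure_pmf.prob ?M G"
    unfolding G_def by (rule binomial_pmf_log2_approx[OF q]) (simp add: R_def)
  also have "\<dots> \<le> measure (measure_spmf (run approx_count ?x))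
      {z. \<exists>h\<in>G. case z of (y, t) \<Rightarrow> y = int_tree (\<mu> + int (log2 h)) \<and>
        t \<le> 80 * n + (round_cost n F + 182) * 2 ^ d}"
    using rel_spmf_measureD[OF rel_spmf_approx_count[OF F \<mu>], of G] by (simp add: d_def)
  also have "\<dots> \<le> measure (measure_spmf (run approx_count ?x)) {(y, t). good y}"
    using good by (intro measure_spmf.finite_measure_mono) auto
  finally show "2 / 3 \<le> prob_output approx_count ?x (\<lambda>y. \<exists>u :: int. y = int_tree u \<and> u \<ge> \<mu> \<and>
           2 powi (u + 3) \<ge> real (count_sat n F) \<and>
           (u > \<mu> \<longrightarrow>
              1 / 16 * real (count_sat n F) \<le> 2 powi u \<and>
              2 powi u \<le> 16 * real (count_sat n F)))"
    unfolding prob_output_def good_def .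
qed

end
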